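(* Let $q\in(1,+\infty)$, $T>0$ and $p=q/(q-1)$. For $t\in[0,T]$, $x\le 0$ and $v\in\mathbb R$, let $$\phi(t,x,v)=\inf \frac 1q\int_t^T|\xi''(s)|^q\,ds,$$ where the infimum is taken over all $\xi\in W^{2,q}(0,T)$ such that $\xi(t)=x$, $\xi'(t)=v$ and $\xi(s)\in(-\infty,0]$ for all $s\in[t,T]$. Then: \begin{itemize} \item $\phi(t,x,v)=0$ if $v(T-t)\le |x|$; \item $\displaystyle \phi(t,x,v)=\frac{(2q-1)^{q-1}}{q(q-1)^{q-1}}\,\frac{\left(v-\frac{|x|}{T-t}\right)^q}{(T-t)^{q-1}}$ if $|x|\le v(T-t)\le \frac{(2q-1)|x|}{q-1}$; \item $\displaystyle \phi(t,x,v)=\frac{q^{q-1}}{(2q-1)^q}\,\frac{v^{2q-1}}{|x|^{q-1}}$ if $v(T-t)\ge \frac{(2q-1)|x|}{q-1}>0$. \end{itemize} Moreover $\phi$ is of class $C^1$ in $[0,T]\times(-\infty,0)\times\mathbb R$ and satisfies pointwise in this set the equation $$-\frac{\partial\phi}{\partial t}(t,x,v)-v\frac{\partial\phi}{\partial x}(t,x,v)+\frac1p\left|\frac{\partial\phi}{\partial v}(t,x,v)\right|^p=0.$$ Finally, for each $(t,x,v)\in[0,T]\times(-\infty,0]\times\mathbb R$, the optimal control problem defining $\phi(t,x,v)$ has a unique minimizer.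
   Formalization: The unique minimizer is claimed only when an admissible ξ exists (none does for x=0, v>0, t<T), with uniqueness meant on [t,T], since values on [0,t) are free; the second formula is stated for t<T, as it is 0/0 at t=T, x=0. *)

theory Defs
  imports "HOL-Analysis.Analysis"
begin

text \<open>Representation of W^{2,q}(0,T): a function xi on [0,T] whose derivative xi' exists on
  [0,T] (one-sided at the endpoints) and is an indefinite Lebesgue integral of a function
  g in L^q(0,T); g is then the (a.e. unique) second weak derivative xi''.\<close>
definition sobolev2 :: "real \<Rightarrow> real \<Rightarrow> (real \<Rightarrow> real) \<Rightarrow> (real \<Rightarrow> real) \<Rightarrow> (real \<Rightarrow> real) \<Rightarrow> bool" where
  "sobolev2 q T xi xi' g \<longleftrightarrow>
     set_integrable lborel {0..T} g \<and>
     set_integrable lborel {0..T} (\<lambda>s. \<bar>g s\<bar> powr q) \<and>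
     (\<forall>s\<in>{0..T}. (xi has_real_derivative xi' s) (at s within {0..T})) \<and>
     (\<forall>s\<in>{0..T}. xi' s = xi' 0 + (LINT r:{0..s}|lborel. g r))"

definition adm :: "real \<Rightarrow> real \<Rightarrow> real \<Rightarrow> real \<Rightarrow> real
     \<Rightarrow> ((real \<Rightarrow> real) \<times> (real \<Rightarrow> real) \<times> (real \<Rightarrow> real)) set" where
  "adm q T t x v = {(xi, xi', g). sobolev2 q T xi xi' g \<and> xi t = x \<and> xi' t = v \<and>
                                  (\<forall>s\<in>{t..T}. xi s \<le> 0)}"

definition cost :: "real \<Rightarrow> real \<Rightarrow> real \<Rightarrow> (real \<Rightarrow> real) \<Rightarrow> real" where
  "cost q T t g = (1 / q) * (LINT s:{t..T}|lborel. \<bar>g s\<bar> powr q)"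

text \<open>Value function (extended real; +infinity when no admissible trajectory exists).\<close>
definition phi :: "real \<Rightarrow> real \<Rightarrow> real \<Rightarrow> real \<Rightarrow> real \<Rightarrow> ereal" where
  "phi q T t x v = (INF m \<in> adm q T t x v. ereal (cost q T t (snd (snd m))))"

end

theory Submission
  imports Defs
begin

text \<open>Write \<open>p = q / (q - 1)\<close>. The candidate minimizer has acceleration
  \<open>h(s) = - c (\<tau> - s)\<^sub>+ powr (p - 1)\<close>, where \<open>\<tau>\<close> is the final time or an earlier time at which
  the trajectory comes to rest at the origin. Convexity of \<open>|u| powr q\<close> gives, pointwise, a tangent
  inequality at \<open>h(s)\<close> whose slope is \<open>- c powr (q - 1) (\<tau> - s)\<^sub>+\<close>, since \<open>(p - 1) (q - 1) = 1\<close>;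
  integrated against the Taylor formula
  \<open>\<xi>(\<tau>) = \<xi>(t) + \<xi>'(t) (\<tau> - t) + \<integral> (\<tau> - s) \<xi>''(s) ds\<close> over \<open>[t, \<tau>]\<close>
  it shows that the cost of any competitor \<open>\<xi>\<close> exceeds that of the candidate by at least
  \<open>- c powr (q - 1) \<xi>(\<tau>) \<ge> 0\<close>. Strictness of the tangent inequality yields uniqueness.
  For \<open>x < 0\<close> the value is self-similar,
  \<open>\<phi>(t, x, v) = v\<^sub>+ powr (2 q - 1) |x| powr (1 - q) \<psi>(v (T - t) / |x|)\<close> with a profile \<open>\<psi>\<close> that is
  \<open>C\<^sup>1\<close> on the whole line, so that regularity and the Hamilton-Jacobi equation reduce to statements
  about \<open>\<psi>\<close>.\<close>

section \<open>Strict convexity of powers and differentiability of truncated powers\<close>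

text \<open>By the mean value theorem the chord from \<open>k\<close> to a positive \<open>u\<close>
  has slope \<open>z powr (q - 1)\<close> with \<open>z\<close> strictly between them, and this
  power is strictly increasing. For \<open>u \<le> 0 < k\<close> the tangent is already negative at
  \<open>u\<close>, since \<open>k powr q / q < k powr q\<close>. Strictness is what later forces
  minimizers to coincide.\<close>

lemma abs_powr_tangent_less:
  fixes q k u :: real
  assumes "q > 1" "k \<ge> 0" "u \<noteq> k"
  shows "k powr q / q + k powr (q - 1) * (u - k) < \<bar>u\<bar> powr q / q"
proof -
  have split: "y powr q = y powr (q - 1) * y" if "y \<ge> 0" for y :: real
    using powr_mult_base[OF that, of "q - 1"] by (simp add: mult.commute)
  consider "k = 0" | "k > 0" "u \<le> 0" | "k > 0" "u > k" | "0 < u" "u < k"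
    using assms by linarith
  then show ?thesis
  proof cases
    case 1
    then show ?thesis using assms by simp
  next
    case 2
    have "k powr q / q < k powr q"
      using assms 2 by (simp add: field_simps)
    moreover have "k powr (q - 1) * u \<le> 0"
      using 2 by (simp add: mult_nonneg_nonpos)
    moreover have "0 \<le> \<bar>u\<bar> powr q / q"
      using assms by simp
    ultimately show ?thesis
      using split[OF \<open>k \<ge> 0\<close>] by (simp add: algebra_simps)
  next
    case 3
    have "\<exists>z. k < z \<and> z < u \<and> u powr q - k powr q = (u - k) * (q * z powr (q - 1))"
      using 3 by (intro MVT2) (auto intro!: has_real_derivative_powr)
    then obtain z where z: "k < z" "u powr q - k powr q = (u - k) * (q * z powr (q - 1))"
      by auto
    have "k powr (q - 1) < z powr (q - 1)"
      using z(1) assms by (intro powr_less_mono2) auto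
    then have "(u - k) * k powr (q - 1) < (u - k) * z powr (q - 1)"
      using 3 by simp
    moreover have "u powr q / q = k powr q / q + (u - k) * z powr (q - 1)"
      using z(2) assms by (simp add: field_simps)
    ultimately show ?thesis
      using 3 by (simp add: mult.commute)
  next
    case 4
    have "\<exists>z. u < z \<and> z < k \<and> k powr q - u powr q = (k - u) * (q * z powr (q - 1))"
      using 4 by (intro MVT2) (auto intro!: has_real_derivative_powr)
    then obtain z where z: "u < z" "z < k" "k powr q - u powr q = (k - u) * (q * z powr (q - 1))"
      by auto
    have "z powr (q - 1) < k powr (q - 1)"
      using z 4 assms by (intro powr_less_mono2) auto
    then have "(k - u) * z powr (q - 1) < (k - u) * k powr (q - 1)"
      using 4 by simp
    moreover have "u powr q / q = k powr q / q - (k - u) * z powr (q - 1)"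
      using z(3) assms by (simp add: field_simps)
    ultimately show ?thesis
      using 4 by (simp add: algebra_simps)
  qed
qed

lemma abs_powr_tangent_le:
  fixes q k u :: real
  assumes "q > 1" "k \<ge> 0"
  shows "k powr q / q + k powr (q - 1) * (u - k) \<le> \<bar>u\<bar> powr q / q"
  using abs_powr_tangent_less[OF assms, of u] assms by (cases "u = k") auto

text \<open>Away from the kink this is the usual power rule. At 0 the difference quotient is at most
  \<open>\<bar>h\<bar> powr (a - 1)\<close> in modulus, which tends to 0 because
  \<open>a > 1\<close>.\<close>

lemma has_real_derivative_pos_part_powr:
  fixes a y :: real
  assumes "a > 1"
  shows "((\<lambda>y. max 0 y powr a) has_real_derivative a * max 0 y powr (a - 1)) (at y)"
proof -
  consider "y > 0" | "y < 0" | "y = 0" by linarith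
  then show ?thesis
  proof cases
    case 1
    have "((\<lambda>y. y powr a) has_real_derivative a * y powr (a - 1)) (at y)"
      using 1 by (rule has_real_derivative_powr)
    then have "((\<lambda>y. max 0 y powr a) has_real_derivative a * y powr (a - 1)) (at y)"
      by (rule has_field_derivative_transform_within_open[where S = "{0<..}"]) (use 1 in auto)
    then show ?thesis using 1 by simp
  next
    case 2
    have "((\<lambda>y. 0) has_real_derivative 0) (at y)"
      by simp
    then have "((\<lambda>y. max 0 y powr a) has_real_derivative 0) (at y)"
      by (rule has_field_derivative_transform_within_open[where S = "{..<0}"])
        (use 2 in \<open>auto simp: max_def\<close>)
    then show ?thesis using 2 by (simp add: max_def)
  next
    case 3
    have "((\<lambda>h::real. \<bar>h\<bar> powr (a - 1)) \<longlongrightarrow> 0) (at 0)"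
      using assms by (auto intro!: tendsto_eq_intros)
    moreover have "\<forall>\<^sub>F h::real in at 0. norm (max 0 h powr a / h) \<le> \<bar>h\<bar> powr (a - 1)"
    proof (intro always_eventually allI)
      fix h :: real
      show "norm (max 0 h powr a / h) \<le> \<bar>h\<bar> powr (a - 1)"
      proof (cases "h > 0")
        case False
        then have "max 0 h = 0" by simp
        then show ?thesis by (simp only: powr_0) simp
      qed (simp add: powr_diff)
    qed
    ultimately have "((\<lambda>h::real. max 0 h powr a / h) \<longlongrightarrow> 0) (at 0)"
      by (rule Lim_null_comparison[rotated])
    then show ?thesis
      using 3 by (simp add: DERIV_def)
  qed
qed

lemma has_real_derivative_reflected_pos_part_powr:
  fixes a \<tau> s :: real
  assumes "a > 1"
  shows "((\<lambda>s. max 0 (\<tau> - s) powr a) has_real_derivative - (a * max 0 (\<tau> - s) powr (a - 1))) (at s)"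
proof -
  have "((\<lambda>s. \<tau> - s) has_real_derivative - 1) (at s)"
    by (auto intro!: derivative_eq_intros)
  from DERIV_chain2[where g = "\<lambda>s. \<tau> - s", OF has_real_derivative_pos_part_powr[OF assms] this]
  show ?thesis by simp
qed

section \<open>Sobolev trajectories and Taylor's formula with integral remainder\<close>

text \<open>Fubini on the triangle \<open>a \<le> r \<le> s \<le> b\<close>: for fixed
  \<open>r\<close> the variable \<open>s\<close> runs over an interval of length
  \<open>b - r\<close>.\<close>

lemma double_integral_eq_weighted_integral:
  fixes g :: "real \<Rightarrow> real"
  assumes g: "set_integrable lborel {a..b} g"
  shows "(LINT s:{a..b}|lborel. LINT r:{a..s}|lborel. g r) = (LINT r:{a..b}|lborel. (b - r) * g r)"
proof -
  define G where "G = (\<lambda>r. indicator {a..b} r * g r)"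
  have G: "integrable lborel G"
    using g by (simp add: set_integrable_def G_def)
  have [measurable]: "G \<in> borel_measurable borel"
    using G by (simp add: borel_measurable_integrable)
  define F :: "real \<Rightarrow> real \<Rightarrow> real"
    where "F = (\<lambda>s r. if r \<le> s then indicator {a..b} s * G r else 0)"
  \<comment> \<open>Integrability on the triangle follows by domination from the whole square, where
    the integrand is a product of functions of one variable.\<close>
  have prod: "integrable (lborel \<Otimes>\<^sub>M lborel) (\<lambda>(s::real, r). indicator {a..b} s * G r)"
  proof (rule lborel_pair.Fubini_integrable)
    show "(\<lambda>(s::real, r). indicator {a..b} s * G r) \<in> borel_measurable (lborel \<Otimes>\<^sub>M lborel)"
      by measurable
    have "integrable lborel (\<lambda>s. indicator {a..b} s * (LINT r|lborel. \<bar>G r\<bar>))"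
      by (intro integrable_mult_left) (auto simp: integrable_indicator_iff emeasure_lborel_Icc_eq)
    then show "integrable lborel (\<lambda>x. LINT y|lborel. norm (case (x, y) of (s, r) \<Rightarrow> indicator {a..b} s * G r))"
      by (simp add: abs_mult)
    show "AE x in lborel. integrable lborel (\<lambda>y. case (x, y) of (s, r) \<Rightarrow> indicator {a..b} s * G r)"
      using G by simp
  qed
  have F: "integrable (lborel \<Otimes>\<^sub>M lborel) (case_prod F)"
    by (rule Bochner_Integration.integrable_bound[OF prod]) (auto simp: F_def)
  have "(LINT r|lborel. LINT s|lborel. F s r) = (LINT s|lborel. LINT r|lborel. F s r)"
    by (rule lborel_pair.Fubini_integral[OF F])
  moreover have "(LINT r|lborel. F s r) = indicator {a..b} s * (LINT r:{a..s}|lborel. g r)" for s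
  proof -
    have "F s = (\<lambda>r. indicator {a..b} s * (indicator {a..s} r * g r))"
      by (rule ext) (auto simp: F_def G_def indicator_def)
    then show ?thesis
      by (simp add: set_lebesgue_integral_def)
  qed
  moreover have "(LINT s|lborel. F s r) = indicator {a..b} r * ((b - r) * g r)" for r
  proof -
    \<comment> \<open>The bound \<open>a \<le> s\<close> may be dropped because \<open>G r\<close>
      vanishes unless \<open>a \<le> r\<close>.\<close>
    have "(\<lambda>s. F s r) = (\<lambda>s. indicator {r..b} s * G r)"
      by (rule ext) (auto simp: F_def G_def indicator_def)
    then have "(LINT s|lborel. F s r) = measure lborel {r..b} * G r"
      by simp
    then show ?thesis
      by (simp add: G_def indicator_def)
  qed
  ultimately show ?thesis
    by (simp add: set_lebesgue_integral_def)
qed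

lemma sobolev2D:
  assumes "sobolev2 q T xi xi' g"
  shows "set_integrable lborel {0..T} g"
    and "set_integrable lborel {0..T} (\<lambda>s. \<bar>g s\<bar> powr q)"
    and "s \<in> {0..T} \<Longrightarrow> (xi has_real_derivative xi' s) (at s within {0..T})"
    and "s \<in> {0..T} \<Longrightarrow> xi' s = xi' 0 + (LINT r:{0..s}|lborel. g r)"
  using assms unfolding sobolev2_def by blast+

lemma sobolev2_velocity:
  assumes "sobolev2 q T xi xi' g" "0 \<le> t" "t \<le> s" "s \<le> T"
  shows "xi' s = xi' t + (LINT r:{t..s}|lborel. g r)"
proof -
  note g = sobolev2D(1)[OF assms(1)]
  have sub: "set_integrable lborel {a..b} g" if "0 \<le> a" "b \<le> T" for a b
    using g by (rule set_integrable_subset) (use that in auto)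
  have "integral {0..t} g + integral {t..s} g = integral {0..s} g"
    using assms sub by (intro Henstock_Kurzweil_Integration.integral_combine
        set_borel_integral_eq_integral) auto
  then show ?thesis
    using sobolev2D(4)[OF assms(1), of t] sobolev2D(4)[OF assms(1), of s] assms
    by (simp add: set_borel_integral_eq_integral sub)
qed

lemma sobolev2_continuous_on_velocity:
  assumes "sobolev2 q T xi xi' g" "0 \<le> t"
  shows "continuous_on {t..T} (\<lambda>s. LINT r:{t..s}|lborel. g r)"
proof -
  have sub: "set_integrable lborel {t..s} g" if "s \<le> T" for s
    using sobolev2D(1)[OF assms(1)] by (rule set_integrable_subset) (use that assms in auto)
  have "continuous_on {t..T} (\<lambda>s. integral {t..s} g)"
    by (intro indefinite_integral_continuous_1 set_borel_integral_eq_integral sub) simp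
  then show ?thesis
    by (rule continuous_on_eq) (simp add: set_borel_integral_eq_integral sub)
qed

text \<open>The velocity is continuous, being an indefinite integral, so the fundamental theorem
  recovers \<open>xi\<close> from it; in the remaining double integral of \<open>g\<close> the order
  of integration is exchanged. The position at \<open>\<tau>\<close> thus becomes an affine
  functional of the control.\<close>

lemma sobolev2_taylor:
  assumes "sobolev2 q T xi xi' g" "0 \<le> t" "t \<le> \<tau>" "\<tau> \<le> T"
  shows "xi \<tau> = xi t + xi' t * (\<tau> - t) + (LINT s:{t..\<tau>}|lborel. (\<tau> - s) * g s)"
proof -
  let ?G = "\<lambda>s. LINT r:{t..s}|lborel. g r"
  have cont: "continuous_on {t..\<tau>} ?G"
    using sobolev2_continuous_on_velocity[OF assms(1,2)]
    by (rule continuous_on_subset) (use assms in auto)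
  have vel: "xi' s = xi' t + ?G s" if "s \<in> {t..\<tau>}" for s
    using sobolev2_velocity[OF assms(1), of t s] that assms by auto
  have "(LINT s:{t..\<tau>}|lborel. xi' t + ?G s) = xi \<tau> - xi t"
    unfolding set_lebesgue_integral_def
  proof (rule integral_FTC_atLeastAtMost)
    fix s assume s: "t \<le> s" "s \<le> \<tau>"
    have "(xi has_real_derivative xi' s) (at s within {t..\<tau>})"
      using sobolev2D(3)[OF assms(1), of s]
      by (rule has_field_derivative_subset) (use s assms in auto)
    then show "(xi has_vector_derivative xi' t + (LINT x|lborel. indicat_real {t..s} x *\<^sub>R g x)) (at s within {t..\<tau>})"
      using vel[of s] s by (simp add: has_real_derivative_iff_has_vector_derivative set_lebesgue_integral_def)
  next
    show "continuous_on {t..\<tau>} (\<lambda>s. xi' t + (LINT x|lborel. indicat_real {t..s} x *\<^sub>R g x))"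
      using cont by (intro continuous_intros) (simp add: set_lebesgue_integral_def)
  qed (use assms in auto)
  moreover have "(LINT s:{t..\<tau>}|lborel. xi' t + ?G s) = (LINT s:{t..\<tau>}|lborel. xi' t) + (LINT s:{t..\<tau>}|lborel. ?G s)"
    by (intro set_integral_add borel_integrable_atLeastAtMost' cont continuous_intros)
  moreover have "(LINT s:{t..\<tau>}|lborel. xi' t) = xi' t * (\<tau> - t)"
    using assms by (simp add: set_lebesgue_integral_def)
  moreover have "(LINT s:{t..\<tau>}|lborel. ?G s) = (LINT s:{t..\<tau>}|lborel. (\<tau> - s) * g s)"
    by (intro double_integral_eq_weighted_integral set_integrable_subset[OF sobolev2D(1)[OF assms(1)]])
      (use assms in auto)
  ultimately show ?thesis
    by linarith
qed

section \<open>Verification of optimality and uniqueness\<close>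

text \<open>\<open>c powr (q - 1)\<close> acts as the Lagrange multiplier of the single constraint
  \<open>xi \<tau> \<le> 0\<close>, and \<open>touch\<close> is complementary slackness.\<close>

lemma touching_power_control_optimal:
  fixes q T t \<tau> c :: real
  defines "p \<equiv> q / (q - 1)"
  defines "h \<equiv> (\<lambda>s. - (c * max 0 (\<tau> - s) powr (p - 1)))"
  assumes q: "q > 1" and t: "0 \<le> t" "t \<le> \<tau>" "\<tau> \<le> T" and c: "c \<ge> 0"
    and opt: "(\<eta>, \<eta>', h) \<in> adm q T t x v" and touch: "c = 0 \<or> \<eta> \<tau> = 0"
  shows "phi q T t x v = ereal (cost q T t h)"
    and "\<And>m s. m \<in> adm q T t x v \<Longrightarrow> cost q T t (snd (snd m)) = cost q T t h \<Longrightarrow>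
          s \<in> {t..T} \<Longrightarrow> fst m s = \<eta> s"
proof -
  have sob: "sobolev2 q T \<eta> \<eta>' h" and \<eta>: "\<eta> t = x" "\<eta>' t = v"
    using opt by (auto simp: adm_def)
  define w where "w = (\<lambda>s. max 0 (\<tau> - s))"
  have weight: "(LINT s:{t..T}|lborel. w s * f s) = (LINT s:{t..\<tau>}|lborel. (\<tau> - s) * f s)" for f :: "real \<Rightarrow> real"
    unfolding set_lebesgue_integral_def
    by (intro Bochner_Integration.integral_cong) (use t in \<open>auto simp: w_def indicator_def\<close>)
  have slope: "(- h s) powr (q - 1) = c powr (q - 1) * w s" for s
    using q c by (simp add: h_def w_def p_def powr_mult powr_powr field_simps)
  have h0: "- h s \<ge> 0" for s
    using c by (simp add: h_def)
  \<comment> \<open>\<open>E g\<close> is the gap in the tangent inequality at \<open>h\<close>,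
    expanded into separately integrable terms. As \<open>h\<close> is nonpositive, the inequality is
    applied to \<open>- g\<close> and \<open>- h\<close>.\<close>
  define E where "E = (\<lambda>g s. \<bar>g s\<bar> powr q / q - \<bar>h s\<bar> powr q / q + c powr (q - 1) * (w s * g s) - c powr (q - 1) * (w s * h s))"
  have E: "E g s = \<bar>- g s\<bar> powr q / q - ((- h s) powr q / q + (- h s) powr (q - 1) * (- g s - (- h s)))" for g s
    using h0[of s] by (simp add: E_def slope algebra_simps)
  have E_ge: "E g s \<ge> 0" for g s
    unfolding E using abs_powr_tangent_le[OF q h0, of s "- g s"] by simp
  have E_0: "E g s = 0 \<Longrightarrow> g s = h s" for g s
    unfolding E using abs_powr_tangent_less[OF q h0, of "- g s" s] by (cases "g s = h s") auto
  have key: "cost q T t g - cost q T t h = (LINT s:{t..T}|lborel. E g s) - c powr (q - 1) * xi \<tau>"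
      and intE: "set_integrable lborel {t..T} (E g)"
    if m: "(xi, xi', g) \<in> adm q T t x v" for xi xi' g
  proof -
    have sg: "sobolev2 q T xi xi' g" and xi: "xi t = x" "xi' t = v"
      using m by (auto simp: adm_def)
    have sub: "set_integrable lborel {t..T} f" if "set_integrable lborel {0..T} f" for f :: "real \<Rightarrow> real"
      using that by (rule set_integrable_subset) (use t in auto)
    \<comment> \<open>On \<open>{t..T}\<close> the weight is bounded by \<open>\<tau> - t\<close>,
      so it preserves integrability.\<close>
    have wint: "set_integrable lborel {t..T} (\<lambda>s. w s * f s)"
      if f: "set_integrable lborel {0..T} f" for f
    proof (rule set_integrable_bound)
      show "set_integrable lborel {t..T} (\<lambda>s. (\<tau> - t) * f s)"
        using sub[OF f] by simp
      have [measurable]: "w \<in> borel_measurable borel"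
        unfolding w_def by measurable
      have "set_borel_measurable lborel {t..T} f"
        using sub[OF f] by (simp add: set_integrable_def set_borel_measurable_def)
      then have "(\<lambda>s. w s * (indicator {t..T} s *\<^sub>R f s)) \<in> borel_measurable lborel"
        unfolding set_borel_measurable_def by measurable
      then show "set_borel_measurable lborel {t..T} (\<lambda>s. w s * f s)"
        by (simp add: set_borel_measurable_def mult.left_commute)
      show "AE s in lborel. s \<in> {t..T} \<longrightarrow> norm (w s * f s) \<le> norm ((\<tau> - t) * f s)"
        using t by (auto simp: w_def abs_mult intro!: mult_right_mono)
    qed
    note ints = sub[OF sobolev2D(2)[OF sg]] sub[OF sobolev2D(2)[OF sob]]
      wint[OF sobolev2D(1)[OF sg]] wint[OF sobolev2D(1)[OF sob]]
    show "set_integrable lborel {t..T} (E g)"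
      unfolding E_def by (intro set_integral_add set_integral_diff set_integrable_mult_right set_integrable_divide ints)
    have "(LINT s:{t..T}|lborel. E g s) = (LINT s:{t..T}|lborel. \<bar>g s\<bar> powr q) / q
        - (LINT s:{t..T}|lborel. \<bar>h s\<bar> powr q) / q
        + c powr (q - 1) * (LINT s:{t..T}|lborel. w s * g s)
        - c powr (q - 1) * (LINT s:{t..T}|lborel. w s * h s)"
      unfolding E_def
      by (subst set_integral_diff set_integral_add;
          (intro set_integral_add set_integral_diff set_integrable_mult_right set_integrable_divide ints)?)+ simp
    moreover have "(LINT s:{t..T}|lborel. w s * g s) = xi \<tau> - x - v * (\<tau> - t)"
      using sobolev2_taylor[OF sg t] xi by (simp add: weight)
    moreover have "(LINT s:{t..T}|lborel. w s * h s) = \<eta> \<tau> - x - v * (\<tau> - t)"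
      using sobolev2_taylor[OF sob t] \<eta> by (simp add: weight)
    ultimately have "(LINT s:{t..T}|lborel. E g s) = cost q T t g - cost q T t h
        + c powr (q - 1) * (xi \<tau> - x - v * (\<tau> - t)) - c powr (q - 1) * (\<eta> \<tau> - x - v * (\<tau> - t))"
      by (simp add: cost_def)
    \<comment> \<open>Complementary slackness removes the contribution of the candidate at
      \<open>\<tau>\<close>.\<close>
    moreover have "c powr (q - 1) * \<eta> \<tau> = 0"
      using touch by auto
    ultimately show "cost q T t g - cost q T t h = (LINT s:{t..T}|lborel. E g s) - c powr (q - 1) * xi \<tau>"
      by (auto simp: algebra_simps)
  qed
  have intE_ge: "(LINT s:{t..T}|lborel. E g s) \<ge> 0" for g
    unfolding set_lebesgue_integral_def by (intro Bochner_Integration.integral_nonneg) (simp add: E_ge)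
  have low: "c powr (q - 1) * xi \<tau> \<le> 0" if "(xi, xi', g) \<in> adm q T t x v" for xi xi' g
    using that t by (auto simp: adm_def intro!: mult_nonneg_nonpos)
  show "phi q T t x v = ereal (cost q T t h)"
    unfolding phi_def
  proof (rule antisym)
    show "(INF m\<in>adm q T t x v. ereal (cost q T t (snd (snd m)))) \<le> ereal (cost q T t h)"
      using INF_lower[OF opt, of "\<lambda>m. ereal (cost q T t (snd (snd m)))"] by simp
    show "ereal (cost q T t h) \<le> (INF m\<in>adm q T t x v. ereal (cost q T t (snd (snd m))))"
    proof (rule INF_greatest)
      fix m assume "m \<in> adm q T t x v"
      moreover obtain xi xi' g where "m = (xi, xi', g)" by (cases m)
      ultimately show "ereal (cost q T t h) \<le> ereal (cost q T t (snd (snd m)))"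
        using key[of xi xi' g] low[of xi xi' g] intE_ge[of g] by simp
    qed
  qed
  fix m s assume m: "m \<in> adm q T t x v" and eq: "cost q T t (snd (snd m)) = cost q T t h"
    and s: "s \<in> {t..T}"
  obtain xi xi' g where m': "m = (xi, xi', g)" by (cases m)
  have sg: "sobolev2 q T xi xi' g" and xi: "xi t = x" "xi' t = v"
    using m m' by (auto simp: adm_def)
  \<comment> \<open>With equal costs the left side of \<open>key\<close> is zero, while the integral
    and \<open>- c powr (q - 1) * xi \<tau>\<close> are both nonnegative; hence the gap integrates
    to 0 and vanishes almost everywhere.\<close>
  have "(LINT s:{t..T}|lborel. E g s) = 0"
    using key[of xi xi' g] low[of xi xi' g] intE_ge[of g] m eq m' by simp
  then have "AE s in lborel. indicator {t..T} s *\<^sub>R E g s = 0"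
    using intE[of xi xi' g] m m'
    by (subst (asm) set_lebesgue_integral_def, subst (asm) integral_nonneg_eq_0_iff_AE)
      (auto simp: set_integrable_def E_ge)
  then have AE: "AE r in lborel. r \<in> {t..T} \<longrightarrow> g r = h r"
    by eventually_elim (auto simp: indicator_def E_0)
  \<comment> \<open>Positions are compared through Taylor's formula at \<open>s\<close>, which sees
    only the data at \<open>t\<close> and the control up to null sets.\<close>
  have "(LINT r:{t..s}|lborel. (s - r) * g r) = (LINT r:{t..s}|lborel. (s - r) * h r)"
  proof -
    have meas: "(\<lambda>r. indicator {t..s} r *\<^sub>R ((s - r) * f r)) \<in> borel_measurable lborel"
      if "set_integrable lborel {0..T} f" for f :: "real \<Rightarrow> real"
    proof -
      have "set_integrable lborel {t..s} f"
        using that by (rule set_integrable_subset) (use t s in auto)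
      then have "(\<lambda>r. (s - r) * (indicator {t..s} r *\<^sub>R f r)) \<in> borel_measurable lborel"
        unfolding set_integrable_def by measurable
      then show ?thesis
        by (simp add: mult.left_commute)
    qed
    show ?thesis
      unfolding set_lebesgue_integral_def
    proof (rule integral_cong_AE)
      show "AE r in lborel. indicator {t..s} r *\<^sub>R ((s - r) * g r) = indicator {t..s} r *\<^sub>R ((s - r) * h r)"
        using AE by eventually_elim (use s in \<open>auto simp: indicator_def\<close>)
    qed (intro meas sobolev2D(1)[OF sg] sobolev2D(1)[OF sob])+
  qed
  then show "fst m s = \<eta> s"
    using sobolev2_taylor[OF sg t(1), of s] sobolev2_taylor[OF sob t(1), of s] xi \<eta> s m' by simp
qed

section \<open>Explicit trajectories and their cost\<close>

text \<open>The control \<open>h\<close> is integrated twice starting from \<open>\<tau>\<close>,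
  where \<open>b\<close> is the position and \<open>a\<close> the velocity; after
  \<open>\<tau>\<close> the motion is uniform. The exponents \<open>p\<close> and
  \<open>p + 1\<close> exceed 1, so the truncated powers are differentiable across
  \<open>\<tau>\<close>.\<close>

lemma adm_power_trajectory:
  fixes q T t \<tau> a b c :: real
  defines "p \<equiv> q / (q - 1)"
  defines "\<eta> \<equiv> (\<lambda>s. b + a * (s - \<tau>) - c * (max 0 (\<tau> - s) powr (p + 1) / (p * (p + 1))))"
    and "\<eta>' \<equiv> (\<lambda>s. a + c * (max 0 (\<tau> - s) powr p / p))"
    and "h \<equiv> (\<lambda>s. - (c * max 0 (\<tau> - s) powr (p - 1)))"
  assumes q: "q > 1" and nonpos: "\<And>s. s \<in> {t..T} \<Longrightarrow> \<eta> s \<le> 0"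
  shows "(\<eta>, \<eta>', h) \<in> adm q T t (\<eta> t) (\<eta>' t)"
proof -
  have p: "p > 1"
    using q by (simp add: p_def field_simps)
  have cont: "continuous_on A h" "continuous_on A (\<lambda>s. \<bar>h s\<bar> powr q)" for A
    unfolding h_def using p q by (auto intro!: continuous_intros continuous_on_powr')
  have d1: "(\<eta> has_real_derivative \<eta>' s) (at s)" for s
  proof -
    have "((\<lambda>s. b + a * (s - \<tau>)) has_real_derivative a) (at s)"
      by (auto intro!: derivative_eq_intros)
    then have "(\<eta> has_real_derivative
        a - c * (- ((p + 1) * max 0 (\<tau> - s) powr (p + 1 - 1)) / (p * (p + 1)))) (at s)"
      unfolding \<eta>_def using p
      by (intro DERIV_diff DERIV_cmult DERIV_cdivide has_real_derivative_reflected_pos_part_powr) simp_all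
    then show ?thesis
      by (rule DERIV_cong) (use p in \<open>simp add: \<eta>'_def\<close>)
  qed
  have d2: "(\<eta>' has_real_derivative h s) (at s)" for s
  proof -
    have "(\<eta>' has_real_derivative 0 + c * (- (p * max 0 (\<tau> - s) powr (p - 1)) / p)) (at s)"
      unfolding \<eta>'_def using p
      by (intro DERIV_add DERIV_const DERIV_cmult DERIV_cdivide has_real_derivative_reflected_pos_part_powr) simp
    then show ?thesis
      using p by (simp add: h_def)
  qed
  have vel: "\<eta>' s = \<eta>' 0 + (LINT r:{0..s}|lborel. h r)" if "s \<ge> 0" for s
    using integral_FTC_atLeastAtMost[OF that, of \<eta>' h] cont d2
    by (simp add: set_lebesgue_integral_def has_field_derivative_at_within
        has_real_derivative_iff_has_vector_derivative[symmetric])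
  have "sobolev2 q T \<eta> \<eta>' h"
    unfolding sobolev2_def
  proof (intro conjI ballI)
    fix s assume "s \<in> {0..T}"
    then show "\<eta>' s = \<eta>' 0 + (LINT r:{0..s}|lborel. h r)"
      by (intro vel) simp
  qed (rule borel_integrable_atLeastAtMost' has_field_derivative_at_within, rule cont d1)+
  then show ?thesis
    using nonpos by (simp add: adm_def)
qed

text \<open>Since \<open>(p - 1) * q = p\<close>, the integrand is a multiple of
  \<open>max 0 (\<tau> - s) powr p\<close>, whose antiderivative \<open>F\<close> vanishes at
  \<open>T\<close> because \<open>\<tau> \<le> T\<close>.\<close>

lemma cost_power_control:
  fixes q T t \<tau> c :: real
  defines "p \<equiv> q / (q - 1)"
  assumes q: "q > 1" and "t \<le> \<tau>" "\<tau> \<le> T" and c: "c \<ge> 0"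
  shows "cost q T t (\<lambda>s. - (c * max 0 (\<tau> - s) powr (p - 1)))
       = c powr q * (\<tau> - t) powr (p + 1) / (q * (p + 1))"
proof -
  have p: "p > 1"
    using q by (simp add: p_def field_simps)
  define F where "F = (\<lambda>s. - (c powr q * (max 0 (\<tau> - s) powr (p + 1) / (p + 1))))"
  have F: "(F has_real_derivative c powr q * max 0 (\<tau> - s) powr p) (at s)" for s
  proof -
    have "(F has_real_derivative - (c powr q * (- ((p + 1) * max 0 (\<tau> - s) powr (p + 1 - 1)) / (p + 1)))) (at s)"
      unfolding F_def using p
      by (intro DERIV_minus DERIV_cmult DERIV_cdivide has_real_derivative_reflected_pos_part_powr) simp
    then show ?thesis
      by (rule DERIV_cong) (use p in simp)
  qed
  have "(p - 1) * q = p"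
    using q by (simp add: p_def field_simps)
  then have "\<bar>- (c * max 0 (\<tau> - s) powr (p - 1))\<bar> powr q = c powr q * max 0 (\<tau> - s) powr p" for s
    using c by (simp add: abs_mult powr_mult powr_powr)
  moreover have "(LINT s:{t..T}|lborel. c powr q * max 0 (\<tau> - s) powr p) = F T - F t"
    unfolding set_lebesgue_integral_def
  proof (rule integral_FTC_atLeastAtMost)
    show "continuous_on {t..T} (\<lambda>s. c powr q * max 0 (\<tau> - s) powr p)"
      using p by (auto intro!: continuous_intros continuous_on_powr')
  qed (use assms F in \<open>auto simp: has_field_derivative_at_within
        has_real_derivative_iff_has_vector_derivative[symmetric]\<close>)
  ultimately show ?thesis
    using assms by (simp add: cost_def F_def)
qed

section \<open>Value and minimizers in the slow and fast regimes\<close>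

text \<open>Uniform motion stays nonpositive up to \<open>T\<close> and costs nothing. It is the
  candidate with \<open>c = 0\<close>, for which the optimality criterion asks for no contact with
  the origin.\<close>

lemma phi_slow:
  fixes q T t x v :: real
  assumes "q > 1" "t \<in> {0..T}" "x \<le> 0" "v * (T - t) \<le> - x"
  shows "phi q T t x v = 0"
    and "\<exists>m\<in>adm q T t x v. ereal (cost q T t (snd (snd m))) = phi q T t x v"
    and "\<lbrakk>m1 \<in> adm q T t x v; m2 \<in> adm q T t x v; ereal (cost q T t (snd (snd m1))) = phi q T t x v;
           ereal (cost q T t (snd (snd m2))) = phi q T t x v; s \<in> {t..T}\<rbrakk> \<Longrightarrow> fst m1 s = fst m2 s"
proof -
  have nonpos: "x + v * (s - t) \<le> 0" if "s \<in> {t..T}" for s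
  proof (cases "v \<ge> 0")
    case True
    have "v * (s - t) \<le> v * (T - t)"
      using True that by (intro mult_left_mono) auto
    then show ?thesis using assms by simp
  next
    case False
    then have "v * (s - t) \<le> 0"
      using that by (intro mult_nonpos_nonneg) auto
    then show ?thesis using assms by simp
  qed
  let ?p = "q / (q - 1)"
  \<comment> \<open>The vanishing terms keep the candidate in the literal form of
    \<open>adm_power_trajectory\<close>, with \<open>\<tau> = t\<close>.\<close>
  let ?\<eta> = "\<lambda>s. x + v * (s - t) - 0 * (max 0 (t - s) powr (?p + 1) / (?p * (?p + 1)))"
  let ?\<eta>' = "\<lambda>s. v + 0 * (max 0 (t - s) powr ?p / ?p)"
  let ?h = "\<lambda>s. - (0 * max 0 (t - s) powr (?p - 1))"
  have opt: "(?\<eta>, ?\<eta>', ?h) \<in> adm q T t x v"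
    using adm_power_trajectory[of q t T x v t 0] assms nonpos by simp
  have cost: "cost q T t ?h = 0"
    by (simp add: cost_def)
  note ver = touching_power_control_optimal[of q t t T 0 ?\<eta> ?\<eta>' x v]
  show phi: "phi q T t x v = 0"
    using ver(1) opt cost assms by simp
  show "\<exists>m\<in>adm q T t x v. ereal (cost q T t (snd (snd m))) = phi q T t x v"
    using opt cost by (intro bexI[OF _ opt]) (simp add: phi)
  show "\<lbrakk>m1 \<in> adm q T t x v; m2 \<in> adm q T t x v; ereal (cost q T t (snd (snd m1))) = phi q T t x v;
           ereal (cost q T t (snd (snd m2))) = phi q T t x v; s \<in> {t..T}\<rbrakk> \<Longrightarrow> fst m1 s = fst m2 s"
    using ver(2)[of m1 s] ver(2)[of m2 s] opt cost assms phi by simp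
qed

text \<open>The horizon \<open>\<tau>\<close> is either the final time, or the time at which the optimal trajectory
  reaches the origin with zero velocity and then stays there.\<close>

lemma phi_fast:
  fixes q T t \<tau> x v :: real
  defines "p \<equiv> q / (q - 1)"
  assumes q: "q > 1" and t: "0 \<le> t" "t < \<tau>" "\<tau> \<le> T"
    and reach: "- x \<le> v * (\<tau> - t)" "v * (\<tau> - t) \<le> (p + 1) * - x"
    and stop: "\<tau> = T \<or> v * (\<tau> - t) = (p + 1) * - x"
  shows "phi q T t x v = ereal ((p + 1) powr (q - 1) / q * (v * (\<tau> - t) + x) powr q * (\<tau> - t) powr (1 - 2 * q))"
    and "\<exists>m\<in>adm q T t x v. ereal (cost q T t (snd (snd m))) = phi q T t x v"
    and "\<lbrakk>m1 \<in> adm q T t x v; m2 \<in> adm q T t x v; ereal (cost q T t (snd (snd m1))) = phi q T t x v;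
           ereal (cost q T t (snd (snd m2))) = phi q T t x v; s \<in> {t..T}\<rbrakk> \<Longrightarrow> fst m1 s = fst m2 s"
proof -
  have p: "p > 1"
    using q by (simp add: p_def field_simps)
  define L where "L = \<tau> - t"
  have L: "L > 0" using t by (simp add: L_def)
  \<comment> \<open>The constants \<open>c\<close> and \<open>a\<close> solve
    \<open>\<eta> t = x\<close> and \<open>\<eta>' t = v\<close> for a trajectory with
    \<open>\<eta> \<tau> = 0\<close>: eliminating the arrival velocity \<open>a\<close> leaves
    \<open>v * L + x = c * L powr (p + 1) / (p + 1)\<close>.\<close>
  define c where "c = (v * L + x) * (p + 1) / L powr (p + 1)"
  define a where "a = v - c * (L powr p / p)"
  have c: "c \<ge> 0"
    using reach p by (simp add: c_def L_def)
  have cL: "c * L powr p = (v * L + x) * (p + 1) / L"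
    using L by (simp add: c_def powr_add)
  have a: "a * (p * L) = (p + 1) * - x - v * L"
  proof -
    have "a * (p * L) = v * p * L - (c * L powr p) * L"
      using p by (simp add: a_def field_simps)
    moreover have "(c * L powr p) * L = (v * L + x) * (p + 1)"
      using L by (simp add: cL)
    ultimately show ?thesis
      by (simp add: algebra_simps)
  qed
  \<comment> \<open>The upper bound in \<open>reach\<close> says that the arrival velocity is not
    negative; equality in it means arrival at rest.\<close>
  have a_ge: "a \<ge> 0"
    using a reach p L by (simp add: L_def zero_le_mult_iff) (smt (verit, best) mult_pos_pos zero_le_mult_iff)
  have a_0: "\<tau> = T \<or> a = 0"
    using a stop p L by (auto simp: L_def)
  let ?\<eta> = "\<lambda>s. 0 + a * (s - \<tau>) - c * (max 0 (\<tau> - s) powr (p + 1) / (p * (p + 1)))"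
  let ?\<eta>' = "\<lambda>s. a + c * (max 0 (\<tau> - s) powr p / p)"
  let ?h = "\<lambda>s. - (c * max 0 (\<tau> - s) powr (p - 1))"
  \<comment> \<open>Up to \<open>\<tau>\<close> both terms are nonpositive. If there are later
    times, then \<open>\<tau> < T\<close>, so \<open>a = 0\<close> and the trajectory rests at the
    origin.\<close>
  have nonpos: "?\<eta> s \<le> 0" if "s \<in> {t..T}" for s
  proof -
    have "a * (s - \<tau>) \<le> 0"
      using a_0 a_ge that by (cases "a = 0") (auto intro!: mult_nonneg_nonpos)
    moreover have "0 \<le> c * (max 0 (\<tau> - s) powr (p + 1) / (p * (p + 1)))"
      using c p by (intro mult_nonneg_nonneg divide_nonneg_nonneg) auto
    ultimately show ?thesis by linarith
  qed
  have \<eta>'t: "?\<eta>' t = v"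
    using L by (simp add: a_def L_def)
  have \<eta>t: "?\<eta> t = x"
  proof -
    have "c * L powr (p + 1) = (v * L + x) * (p + 1)"
      using L by (simp add: c_def)
    then have "c * (L powr (p + 1) / (p * (p + 1))) = (v * L + x) * (p + 1) / (p * (p + 1))"
      by simp
    then have "c * (L powr (p + 1) / (p * (p + 1))) = (v * L + x) / p"
      using p by simp
    moreover have "a * L = ((p + 1) * - x - v * L) / p"
      using a p by (simp add: field_simps)
    ultimately have "- (a * L) - c * (L powr (p + 1) / (p * (p + 1)))
        = - (((p + 1) * - x - v * L) / p) - (v * L + x) / p"
      by simp
    also have "\<dots> = x"
      using p by (simp add: field_simps)
    finally have "- (a * L) - c * (L powr (p + 1) / (p * (p + 1))) = x" .
    then show ?thesis
      using L by (simp add: L_def algebra_simps)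
  qed
  have opt: "(?\<eta>, ?\<eta>', ?h) \<in> adm q T t x v"
    using adm_power_trajectory[of q t T 0 a \<tau> c, folded p_def] q nonpos \<eta>t \<eta>'t by auto
  have "cost q T t ?h = c powr q * L powr (p + 1) / (q * (p + 1))"
    using cost_power_control[of q t \<tau> T c] q t c by (simp add: L_def p_def)
  also have "\<dots> = (p + 1) powr (q - 1) / q * (v * L + x) powr q * L powr (1 - 2 * q)"
  proof -
    have "c powr q = (v * L + x) powr q * (p + 1) powr q / L powr ((p + 1) * q)"
      using reach p L by (simp add: c_def L_def powr_divide powr_mult powr_powr)
    moreover have "L powr (1 - 2 * q) = L powr (p + 1) / L powr ((p + 1) * q)"
    proof -
      have "p * (q - 1) = q"
        using q by (simp add: p_def)
      then have "1 - 2 * q = (p + 1) - (p + 1) * q"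
        by (simp add: algebra_simps)
      then show ?thesis by (simp only: powr_diff)
    qed
    moreover have "(p + 1) powr (q - 1) = (p + 1) powr q / (p + 1)"
      using p by (simp add: powr_diff)
    ultimately show ?thesis
      by (simp add: mult_ac)
  qed
  finally have cost: "cost q T t ?h = (p + 1) powr (q - 1) / q * (v * L + x) powr q * L powr (1 - 2 * q)" .
  note ver = touching_power_control_optimal[of q t \<tau> T c ?\<eta> ?\<eta>' x v, folded p_def]
  have phi: "phi q T t x v = ereal (cost q T t ?h)"
    using ver(1) opt q t c by simp
  then show "phi q T t x v = ereal ((p + 1) powr (q - 1) / q * (v * (\<tau> - t) + x) powr q * (\<tau> - t) powr (1 - 2 * q))"
    by (simp add: cost L_def)
  show "\<exists>m\<in>adm q T t x v. ereal (cost q T t (snd (snd m))) = phi q T t x v"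
    using phi by (intro bexI[OF _ opt]) simp
  show "\<lbrakk>m1 \<in> adm q T t x v; m2 \<in> adm q T t x v; ereal (cost q T t (snd (snd m1))) = phi q T t x v;
           ereal (cost q T t (snd (snd m2))) = phi q T t x v; s \<in> {t..T}\<rbrakk> \<Longrightarrow> fst m1 s = fst m2 s"
    using ver(2)[of m1 s] ver(2)[of m2 s] opt q t c phi by simp
qed

text \<open>A positive velocity at the origin carries the trajectory above 0 at once. For these data
  the value is infinite, and they are set aside in the claim on minimizers.\<close>

lemma adm_boundary_outward_empty:
  fixes T t v :: real
  assumes "0 \<le> t" "t < T" "v > 0"
  shows "adm q T t 0 v = {}"
proof -
  have False if m: "(xi, xi', g) \<in> adm q T t 0 v" for xi xi' g
  proof -
    have sob: "sobolev2 q T xi xi' g" and xi: "xi t = 0" "xi' t = v" "\<forall>s\<in>{t..T}. xi s \<le> 0"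
      using m by (auto simp: adm_def)
    have "(xi has_real_derivative v) (at t within {0..T})"
      using sobolev2D(3)[OF sob, of t] xi assms by auto
    then obtain d where d: "d > 0" "\<forall>h>0. t + h \<in> {0..T} \<longrightarrow> h < d \<longrightarrow> xi t < xi (t + h)"
      using has_real_derivative_pos_inc_right assms by blast
    define h where "h = min (d / 2) (T - t)"
    have "h > 0" "h < d" "t + h \<in> {0..T}" "t + h \<in> {t..T}"
      using d assms by (auto simp: h_def)
    then show False
      using d(2) xi by fastforce
  qed
  then show ?thesis by auto
qed

section \<open>The self-similar profile and its differential equation\<close>

text \<open>The value for \<open>x = - 1\<close>, \<open>v = 1\<close> and remaining time
  \<open>z \<ge> 0\<close>. The constant \<open>k\<close> equals \<open>p + 1\<close>; truncation at
  \<open>k\<close> encodes that the optimal trajectory, given more time, stops early at the origin,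
  and the positive part encodes the free regime below 1.\<close>

definition profile :: "real \<Rightarrow> real \<Rightarrow> real" where
  "profile q z = (let k = (2 * q - 1) / (q - 1); m = min z k in
     k powr (q - 1) / q * (max 0 (m - 1) powr q * m powr (1 - 2 * q)))"

text \<open>One formula covers all regimes, so continuity needs no gluing: the last factor cuts off
  beyond the truncation point, and \<open>max 1 z\<close> keeps the negative power away from
  0.\<close>

definition profile' :: "real \<Rightarrow> real \<Rightarrow> real" where
  "profile' q z = ((2 * q - 1) / (q - 1)) powr (q - 1) / q *
     (max 0 (z - 1) powr (q - 1) * max 1 z powr (- 2 * q) * max 0 ((2 * q - 1) - (q - 1) * z))"

text \<open>Each difference quotient of the truncated function is either that of \<open>f\<close> or
  0, so it inherits the limit 0. This joins the profile to its constant part at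
  \<open>k\<close>.\<close>

lemma has_real_derivative_min_critical:
  fixes f :: "real \<Rightarrow> real"
  assumes "(f has_real_derivative 0) (at k)"
  shows "((\<lambda>z. f (min z k)) has_real_derivative 0) (at k)"
proof -
  have "((\<lambda>h. (f (k + h) - f k) / h) \<longlongrightarrow> 0) (at 0)"
    using assms by (simp add: DERIV_def)
  then have "((\<lambda>h. norm ((f (k + h) - f k) / h)) \<longlongrightarrow> 0) (at 0)"
    by (rule tendsto_norm_zero)
  moreover have "\<forall>\<^sub>F h in at 0. norm ((f (min (k + h) k) - f k) / h) \<le> norm ((f (k + h) - f k) / h)"
    by (intro always_eventually allI) (auto simp: min_def)
  ultimately have "((\<lambda>h. (f (min (k + h) k) - f k) / h) \<longlongrightarrow> 0) (at 0)"
    by (rule Lim_null_comparison[rotated])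
  then show ?thesis
    by (simp add: DERIV_def)
qed

lemma profile_eq_0: "z \<le> 1 \<Longrightarrow> profile q z = 0"
  by (simp add: profile_def Let_def max_absorb1)

lemma profile'_eq_0: "z \<le> 1 \<Longrightarrow> profile' q z = 0"
  by (simp add: profile'_def max_absorb1)

text \<open>The product rule applies to the untruncated \<open>f\<close> on
  \<open>0 < z \<le> k\<close>, where the exponent \<open>q > 1\<close> absorbs the kink at 1; at
  \<open>k\<close> the derivative vanishes, so truncation preserves it.\<close>

lemma has_real_derivative_profile:
  fixes q z :: real
  assumes q: "q > 1"
  shows "(profile q has_real_derivative profile' q z) (at z)"
proof -
  define k where "k = (2 * q - 1) / (q - 1)"
  define K where "K = k powr (q - 1) / q"
  define f where "f = (\<lambda>z. K * (max 0 (z - 1) powr q * z powr (1 - 2 * q)))"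
  have k: "k > 1"
    using q by (simp add: k_def field_simps)
  have prof: "profile q = (\<lambda>z. f (min z k))"
    by (rule ext) (simp add: profile_def f_def K_def k_def Let_def)
  have f': "(f has_real_derivative profile' q z) (at z)" if "0 < z" "z \<le> k" for z
  proof -
    have d: "((\<lambda>z. max 0 (z - 1) powr q) has_real_derivative q * max 0 (z - 1) powr (q - 1)) (at z)"
    proof -
      have "((\<lambda>z. z - 1) has_real_derivative 1) (at z)"
        by (auto intro!: derivative_eq_intros)
      from DERIV_chain2[where g = "\<lambda>z. z - 1", OF has_real_derivative_pos_part_powr[OF q] this]
      show ?thesis by simp
    qed
    have "(f has_real_derivative K * ((q * max 0 (z - 1) powr (q - 1)) * z powr (1 - 2 * q)
        + (1 - 2 * q) * z powr (1 - 2 * q - 1) * max 0 (z - 1) powr q)) (at z)"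
      unfolding f_def using that by (intro DERIV_cmult DERIV_mult d has_real_derivative_powr)
    then show ?thesis
    proof (rule DERIV_cong)
      show "K * ((q * max 0 (z - 1) powr (q - 1)) * z powr (1 - 2 * q)
        + (1 - 2 * q) * z powr (1 - 2 * q - 1) * max 0 (z - 1) powr q) = profile' q z"
      proof (cases "z \<le> 1")
        case True
        then show ?thesis by (simp add: profile'_eq_0 max_absorb1)
      next
        case False
        \<comment> \<open>Both terms of the product rule share \<open>K * A * B\<close>; the
          cofactor is
          \<open>q * z + (1 - 2 * q) * (z - 1) = (2 * q - 1) - (q - 1) * z\<close>.\<close>
        define A where "A = (z - 1) powr (q - 1)"
        define B where "B = z powr (- 2 * q)"
        have pow: "(z - 1) powr q = (z - 1) * A" "z powr (1 - 2 * q) = z * B" "z powr (1 - 2 * q - 1) = B"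
          using False powr_mult_base[of "z - 1" "q - 1"] powr_mult_base[of z "- 2 * q"]
          by (simp_all add: A_def B_def)
        have "profile' q z = K * (A * B * ((2 * q - 1) - (q - 1) * z))"
          using False that q by (simp add: profile'_def K_def k_def A_def B_def field_simps)
        moreover have "max 0 (z - 1) = z - 1"
          using False by simp
        ultimately show ?thesis
          by (simp only: pow A_def[symmetric]) (simp add: algebra_simps)
      qed
    qed
  qed
  \<comment> \<open>The first two cases overlap, so \<open>z = 1\<close> lies inside the range of
    the product rule.\<close>
  consider "z < 1" | "0 < z" "z < k" | "z = k" | "z > k"
    using k by linarith
  then show ?thesis
  proof cases
    case 1
    have "((\<lambda>z. 0) has_real_derivative 0) (at z)" by simp
    then have "(profile q has_real_derivative 0) (at z)"
      by (rule has_field_derivative_transform_within_open[where S = "{..<1}"])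
        (use 1 in \<open>auto simp: profile_eq_0\<close>)
    then show ?thesis using 1 by (simp add: profile'_eq_0)
  next
    case 2
    then have "(f has_real_derivative profile' q z) (at z)"
      by (intro f') auto
    then show ?thesis
      unfolding prof
      by (rule has_field_derivative_transform_within_open[where S = "{..<k}"])
        (use 2 in auto)
  next
    case 3
    have "profile' q k = 0"
      using q by (simp add: profile'_def k_def)
    then show ?thesis
      unfolding prof 3 using has_real_derivative_min_critical[of f k] f'[of k] k by simp
  next
    case 4
    have "((\<lambda>z. f k) has_real_derivative 0) (at z)" by simp
    then have "(profile q has_real_derivative 0) (at z)"
      by (rule has_field_derivative_transform_within_open[where S = "{k<..}"])
        (use 4 in \<open>auto simp: prof\<close>)
    moreover have "profile' q z = 0"
      using 4 q by (simp add: profile'_def k_def field_simps)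
    ultimately show ?thesis by simp
  qed
qed

lemma continuous_on_profile:
  assumes "q > 1"
  shows "continuous_on A (profile q)"
  using has_real_derivative_profile[OF assms] DERIV_isCont
  by (blast intro: continuous_at_imp_continuous_on)

lemma continuous_on_profile':
  assumes "q > 1"
  shows "continuous_on A (profile' q)"
  unfolding profile'_def using assms
  by (intro continuous_intros continuous_on_powr') auto

text \<open>The Hamilton-Jacobi equation for the self-similar form of the value function.\<close>

lemma profile_ode:
  fixes q z :: real
  defines "p \<equiv> q / (q - 1)"
  assumes q: "q > 1"
  shows "(1 - z) * profile' q z - (q - 1) * profile q z
           + (1 / p) * \<bar>(2 * q - 1) * profile q z + z * profile' q z\<bar> powr p = 0"
proof -
  define k where "k = (2 * q - 1) / (q - 1)"
  define K where "K = k powr (q - 1) / q"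
  have k: "k > 1"
    using q by (simp add: k_def field_simps)
  \<comment> \<open>This is the property of \<open>K\<close> that makes the nonlinear term cancel
    the linear ones; it rests on \<open>p * (q - 1) = q\<close> and
    \<open>k * (q - 1) = 2 * q - 1\<close>.\<close>
  have K: "(q * K) powr p / p = (2 * q - 1) * K"
  proof -
    have "(q * K) powr p = k powr q"
      using q by (simp add: K_def powr_powr p_def)
    also have "\<dots> = k * (q * K)"
      using q k powr_mult_base[of k "q - 1"] by (simp add: K_def)
    finally show ?thesis
      using q by (simp add: p_def k_def)
  qed
  have main: "(1 - z) * profile' q z - (q - 1) * profile q z
           + (1 / p) * \<bar>(2 * q - 1) * profile q z + z * profile' q z\<bar> powr p = 0"
    if z: "1 < z" "z \<le> k" for z
  proof -
    define A where "A = (z - 1) powr (q - 1)"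
    define B where "B = z powr (- 2 * q)"
    have "(z - 1) powr q = (z - 1) * A" and zB: "z powr (1 - 2 * q) = z * B"
      using z powr_mult_base[of "z - 1" "q - 1"] powr_mult_base[of z "- 2 * q"]
      by (simp_all add: A_def B_def)
    then have \<psi>: "profile q z = K * ((z - 1) * A * (z * B))"
      using z by (simp add: profile_def K_def k_def[symmetric] Let_def)
    have \<psi>': "profile' q z = K * (A * B * ((2 * q - 1) - (q - 1) * z))"
      using z q by (simp add: profile'_def K_def k_def A_def B_def field_simps)
    \<comment> \<open>The cofactor of \<open>K * A * z * B\<close> collapses:
      \<open>(2 * q - 1) * (z - 1) + (2 * q - 1) - (q - 1) * z = q * z\<close>.\<close>
    have "(2 * q - 1) * profile q z + z * profile' q z = (q * K) * (A * (z * (z * B)))"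
      unfolding \<psi> \<psi>' by algebra
    also have "z * (z * B) = z powr (2 - 2 * q)"
      using z powr_mult_base[of z "1 - 2 * q"] zB by simp
    finally have "\<bar>(2 * q - 1) * profile q z + z * profile' q z\<bar> powr p
        = (q * K) powr p * (A powr p * (z powr (2 - 2 * q)) powr p)"
      using q z by (simp add: K_def A_def abs_mult powr_mult)
    also have "A powr p = (z - 1) * A"
      using q z powr_mult_base[of "z - 1" "q - 1"] by (simp add: A_def powr_powr p_def)
    also have "(z powr (2 - 2 * q)) powr p = B"
    proof -
      have "(2 - 2 * q) * p = - 2 * q"
        using q by (simp add: p_def field_simps)
      then show ?thesis by (simp add: B_def powr_powr)
    qed
    finally have "(1 / p) * \<bar>(2 * q - 1) * profile q z + z * profile' q z\<bar> powr p
        = ((q * K) powr p / p) * ((z - 1) * A * B)"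
      by simp
    also have "\<dots> = (2 * q - 1) * K * ((z - 1) * A * B)"
      by (simp add: K)
    finally show ?thesis
      unfolding \<psi> \<psi>' by (simp add: algebra_simps)
  qed
  consider "z \<le> 1" | "1 < z" "z \<le> k" | "z > k" by linarith
  then show ?thesis
  proof cases
    case 1
    then show ?thesis by (simp add: profile_eq_0 profile'_eq_0)
  next
    case 2
    then show ?thesis by (rule main)
  next
    case 3
    \<comment> \<open>Past \<open>k\<close> the profile is constant, so \<open>z\<close> drops out
      and the equation is the one at \<open>k\<close>.\<close>
    have "profile q z = profile q k"
      using 3 by (simp add: profile_def Let_def k_def[symmetric])
    moreover have "profile' q z = 0" "profile' q k = 0"
      using 3 q by (simp_all add: profile'_def k_def field_simps)
    ultimately show ?thesis
      using main[of k] k by simp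
  qed
qed

section \<open>Self-similar form of the value function\<close>

text \<open>With \<open>y = - x\<close>, the left side is the variable part of the value in the fast
  regime: \<open>y * (z - 1)\<close> is the overshoot of uniform motion over a horizon of length
  \<open>z * y / v\<close>. The powers of \<open>y\<close> combine by
  \<open>q + (1 - 2 * q) = 1 - q\<close>.\<close>

lemma self_similar_scaling:
  fixes q v y z :: real
  assumes "v > 0" "y > 0" "z \<ge> 1"
  shows "(y * (z - 1)) powr q * (z * y / v) powr (1 - 2 * q)
       = v powr (2 * q - 1) * y powr (1 - q) * ((z - 1) powr q * z powr (1 - 2 * q))"
proof -
  have "v powr (2 * q - 1) = 1 / v powr (1 - 2 * q)"
    using powr_minus_divide[of v "1 - 2 * q"] by simp
  moreover have "y powr (1 - q) = y powr q * y powr (1 - 2 * q)"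
    using assms by (simp add: powr_add[symmetric])
  ultimately show ?thesis
    using assms by (simp add: powr_mult powr_divide)
qed

text \<open>\<open>m\<close> measures \<open>v * (\<tau> - t)\<close> in units of
  \<open>- x\<close>. The horizon is \<open>T\<close> as long as this ratio stays below
  \<open>k = p + 1\<close>, the value for arrival at rest, and is cut there otherwise. The
  conclusions are what \<open>phi_fast\<close> requires of \<open>\<tau>\<close>.\<close>

lemma optimal_horizon:
  fixes q T t x v :: real
  assumes q: "q > 1" and t: "t \<in> {0..T}" and x: "x < 0" and fast: "- x < v * (T - t)"
  defines "k \<equiv> q / (q - 1) + 1"
  defines "m \<equiv> min (v * (T - t) / (- x)) k"
  defines "\<tau> \<equiv> t + m * (- x) / v"
  shows "v > 0" "t < \<tau>" "\<tau> \<le> T" "- x \<le> v * (\<tau> - t)" "v * (\<tau> - t) \<le> k * - x"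
    "\<tau> = T \<or> v * (\<tau> - t) = k * - x"
proof -
  define z where "z = v * (T - t) / (- x)"
  have z: "v * (T - t) = z * (- x)" "z > 1"
    using x fast by (simp_all add: z_def field_simps)
  have "v * (T - t) > 0"
    using fast x by linarith
  then show v: "v > 0"
    using t by (auto simp: zero_less_mult_iff)
  have "k > 1"
    using q by (simp add: k_def)
  then have m: "m > 1" "m \<le> k" "m \<le> z" "m = z \<or> m = k"
    unfolding m_def z_def[symmetric] using z(2) by auto
  have vlen: "v * (\<tau> - t) = m * (- x)"
    using v by (simp add: \<tau>_def)
  have T: "T = t + z * (- x) / v"
    unfolding z(1)[symmetric] using v by simp
  show "t < \<tau>"
    using m x v by (simp add: \<tau>_def divide_neg_pos mult_pos_neg)
  show "\<tau> \<le> T"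
    using m x v by (simp add: \<tau>_def T divide_right_mono)
  show "- x \<le> v * (\<tau> - t)" "v * (\<tau> - t) \<le> k * - x"
    using m x by (simp_all add: vlen)
  show "\<tau> = T \<or> v * (\<tau> - t) = k * - x"
    using m(4)
  proof
    assume "m = z"
    then show ?thesis by (simp add: \<tau>_def T)
  qed (simp add: vlen)
qed

text \<open>All regimes merge into one formula, which can be differentiated without case
  distinctions. For \<open>v \<le> 0\<close> the argument of the profile is nonpositive, so both
  sides are 0.\<close>

lemma phi_self_similar:
  fixes q T t x v :: real
  assumes q: "q > 1" and t: "t \<in> {0..T}" and x: "x < 0"
  shows "phi q T t x v
       = ereal (max 0 v powr (2 * q - 1) * (- x) powr (1 - q) * profile q (v * (T - t) / (- x)))"
proof -
  define k where "k = (2 * q - 1) / (q - 1)"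
  have k: "k = q / (q - 1) + 1" "k > 1"
    using q by (simp_all add: k_def field_simps)
  define z where "z = v * (T - t) / (- x)"
  have z: "v * (T - t) = z * (- x)"
    using x by (simp add: z_def)
  show ?thesis
  proof (cases "z \<le> 1")
    case True
    then have "v * (T - t) \<le> - x"
      using x by (simp add: z mult_le_cancel_right)
    then show ?thesis
      unfolding z_def[symmetric]
      using phi_slow(1)[OF q t, of x v] x True by (simp add: profile_eq_0 zero_ereal_def)
  next
    case False
    then have "- x < v * (T - t)"
      using x by (simp add: z)
    note hor = optimal_horizon[OF q t x this, folded k(1) z_def]
    define m where "m = min z k"
    define \<tau> where "\<tau> = t + m * (- x) / v"
    note hor = hor[folded m_def, folded \<tau>_def]
    have v: "v > 0" and m: "m > 1"
      using hor(1) False k by (auto simp: m_def)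
    have len: "\<tau> - t = m * (- x) / v" and vlen: "v * (\<tau> - t) = m * (- x)"
      using v by (simp_all add: \<tau>_def)
    have "phi q T t x v
        = ereal (k powr (q - 1) / q * (v * (\<tau> - t) + x) powr q * (\<tau> - t) powr (1 - 2 * q))"
      using phi_fast(1)[OF q, of t \<tau> T x v] hor t by (simp add: k)
    also have "v * (\<tau> - t) + x = - x * (m - 1)"
      unfolding vlen by (simp add: algebra_simps)
    also have "k powr (q - 1) / q * (- x * (m - 1)) powr q * (\<tau> - t) powr (1 - 2 * q)
        = k powr (q - 1) / q * ((- x * (m - 1)) powr q * (m * (- x) / v) powr (1 - 2 * q))"
      by (simp add: len)
    also have "\<dots> = k powr (q - 1) / q * (v powr (2 * q - 1) * (- x) powr (1 - q) * ((m - 1) powr q * m powr (1 - 2 * q)))"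
      using self_similar_scaling[of v "- x" m q] v x m by simp
    also have "\<dots> = max 0 v powr (2 * q - 1) * (- x) powr (1 - q) * profile q z"
      using v m by (simp add: profile_def Let_def k_def[symmetric] m_def[symmetric])
    finally show ?thesis
      by (simp add: z_def)
  qed
qed

text \<open>At the truncation point \<open>k - 1 = q / (q - 1)\<close>, so the powers of
  \<open>q - 1\<close> cancel. This is the constant of the regime with enough time to stop at the
  origin.\<close>

lemma profile_saturated:
  fixes q z :: real
  assumes q: "q > 1" and z: "z \<ge> (2 * q - 1) / (q - 1)"
  shows "profile q z = q powr (q - 1) / (2 * q - 1) powr q"
proof -
  define k where "k = (2 * q - 1) / (q - 1)"
  have k: "k - 1 = q / (q - 1)" "k > 0"
    using q by (simp_all add: k_def field_simps)
  have "profile q z = k powr (q - 1) / q * ((q / (q - 1)) powr q * k powr (1 - 2 * q))"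
    using z q by (simp add: profile_def Let_def k_def[symmetric] k)
  also have "\<dots> = (q / (q - 1)) powr q * (k powr (q - 1) * k powr (1 - 2 * q)) / q"
    by simp
  also have "k powr (q - 1) * k powr (1 - 2 * q) = k powr (- q)"
    using k by (simp add: powr_add[symmetric])
  also have "\<dots> = (q - 1) powr q / (2 * q - 1) powr q"
    using q by (simp add: k_def powr_minus_divide powr_divide)
  also have "(q / (q - 1)) powr q * ((q - 1) powr q / (2 * q - 1) powr q) / q
      = q powr q / q / (2 * q - 1) powr q"
    using q by (simp add: powr_divide)
  also have "q powr q / q = q powr (q - 1)"
    using q by (simp add: powr_diff)
  finally show ?thesis .
qed

section \<open>Continuous differentiability and the Hamilton-Jacobi equation\<close>

text \<open>The product and chain rules are applied to \<open>V y * X y * profile q (Z y)\<close>;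
  derivatives are within \<open>S\<close>, hence one-sided in time at 0 and \<open>T\<close>. For
  \<open>v > 0\<close> every term of the equation carries the weight
  \<open>v powr (2 * q) * (- x) powr (- q)\<close>, and what remains is
  \<open>profile_ode\<close>.\<close>

lemma phi_C1_solution:
  fixes q T :: real
  defines "p \<equiv> q / (q - 1)" and "S \<equiv> {0..T} \<times> {..<0} \<times> (UNIV :: real set)"
  assumes q: "q > 1"
  shows "\<exists>Pt Px Pv :: real \<times> real \<times> real \<Rightarrow> real.
       continuous_on S Pt \<and> continuous_on S Px \<and> continuous_on S Pv \<and>
       (\<forall>t x v. (t, x, v) \<in> S \<longrightarrow>
          \<bar>phi q T t x v\<bar> \<noteq> \<infinity> \<and>
          ((\<lambda>(t', x', v'). real_of_ereal (phi q T t' x' v')) has_derivative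
             (\<lambda>(dt, dx, dv). Pt (t, x, v) * dt + Px (t, x, v) * dx + Pv (t, x, v) * dv))
            (at (t, x, v) within S) \<and>
          - Pt (t, x, v) - v * Px (t, x, v) + (1 / p) * \<bar>Pv (t, x, v)\<bar> powr p = 0)"
proof -
  define Z :: "real \<times> real \<times> real \<Rightarrow> real"
    where "Z = (\<lambda>y. snd (snd y) * (T - fst y) / (- fst (snd y)))"
  define V :: "real \<times> real \<times> real \<Rightarrow> real"
    where "V = (\<lambda>y. max 0 (snd (snd y)) powr (2 * q - 1))"
  define V' :: "real \<times> real \<times> real \<Rightarrow> real"
    where "V' = (\<lambda>y. max 0 (snd (snd y)) powr (2 * q - 2))"
  define X :: "real \<times> real \<times> real \<Rightarrow> real"
    where "X = (\<lambda>y. (- fst (snd y)) powr (1 - q))"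
  define Pt where "Pt = (\<lambda>y. V y * X y * (profile' q (Z y) * (snd (snd y) / fst (snd y))))"
  define Px where "Px = (\<lambda>y. V y * ((q - 1) * (- fst (snd y)) powr (- q)) * profile q (Z y)
      + V y * X y * (profile' q (Z y) * (Z y / (- fst (snd y)))))"
  define Pv where "Pv = (\<lambda>y. (2 * q - 1) * V' y * X y * profile q (Z y)
      + V y * X y * (profile' q (Z y) * ((T - fst y) / (- fst (snd y)))))"
  have neg: "fst (snd y) < 0" if "y \<in> S" for y
    using that by (auto simp: S_def)
  have Zc: "continuous_on S Z"
    unfolding Z_def using neg by (intro continuous_intros) fastforce
  \<comment> \<open>Since \<open>q > 1\<close>, the exponents \<open>2 * q - 1\<close> and
    \<open>2 * q - 2\<close> are positive, so \<open>V\<close> and \<open>V'\<close> are continuous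
    through \<open>v = 0\<close>.\<close>
  have "continuous_on S (\<lambda>y. max 0 (snd (snd y)) powr r)" if "r > 0" for r
    by (rule continuous_on_powr') (use that in \<open>auto intro!: continuous_intros\<close>)
  then have Vc: "continuous_on S V" "continuous_on S V'"
    unfolding V_def V'_def using q by auto
  have Xc: "continuous_on S (\<lambda>y. (- fst (snd y)) powr r)" for r
    using neg by (intro continuous_on_powr continuous_intros) fastforce
  have pc: "continuous_on S (\<lambda>y. profile q (Z y))" "continuous_on S (\<lambda>y. profile' q (Z y))"
    using continuous_on_compose2[OF continuous_on_profile[OF q] Zc subset_UNIV]
      continuous_on_compose2[OF continuous_on_profile'[OF q] Zc subset_UNIV] by auto
  have "continuous_on S Pt"
    unfolding Pt_def X_def using neg by (intro continuous_intros Vc Xc pc) fastforce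
  moreover have "continuous_on S Px"
    unfolding Px_def X_def using neg by (intro continuous_intros Vc Xc pc Zc) fastforce
  moreover have "continuous_on S Pv"
    unfolding Pv_def X_def using neg by (intro continuous_intros Vc Xc pc) fastforce
  moreover have "\<bar>phi q T t x v\<bar> \<noteq> \<infinity>"
      and "((\<lambda>(t', x', v'). real_of_ereal (phi q T t' x' v')) has_derivative
             (\<lambda>(dt, dx, dv). Pt (t, x, v) * dt + Px (t, x, v) * dx + Pv (t, x, v) * dv))
            (at (t, x, v) within S)"
      and "- Pt (t, x, v) - v * Px (t, x, v) + (1 / p) * \<bar>Pv (t, x, v)\<bar> powr p = 0"
    if S: "(t, x, v) \<in> S" for t x v
  proof -
    have x: "x < 0" and t: "t \<in> {0..T}"
      using S by (auto simp: S_def)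
    let ?y = "(t, x, v)"
    show "\<bar>phi q T t x v\<bar> \<noteq> \<infinity>"
      by (simp add: phi_self_similar[OF q t x])
    have Zd: "(Z has_derivative (\<lambda>d. v / x * fst d + Z ?y / (- x) * fst (snd d) + (T - t) / (- x) * snd (snd d)))
        (at ?y within S)"
      unfolding Z_def using x
      by (auto intro!: derivative_eq_intros ext simp: field_simps power2_eq_square)
    have prof: "((\<lambda>y. profile q (Z y)) has_derivative (\<lambda>d. (v / x * fst d + Z ?y / (- x) * fst (snd d)
        + (T - t) / (- x) * snd (snd d)) * profile' q (Z ?y))) (at ?y within S)"
      by (rule DERIV_compose_FDERIV[OF has_real_derivative_profile[OF q] Zd])
    have Vd: "(V has_derivative (\<lambda>d. snd (snd d) * ((2 * q - 1) * max 0 v powr (2 * q - 2)))) (at ?y within S)"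
    proof -
      have "((\<lambda>y :: real \<times> real \<times> real. snd (snd y)) has_derivative (\<lambda>d. snd (snd d))) (at ?y within S)"
        by (auto intro!: derivative_eq_intros)
      from DERIV_compose_FDERIV[OF has_real_derivative_pos_part_powr this, of "2 * q - 1"]
      show ?thesis using q by (simp add: V_def)
    qed
    have Xd: "(X has_derivative (\<lambda>d. - fst (snd d) * ((1 - q) * (- x) powr (- q)))) (at ?y within S)"
    proof -
      have "((\<lambda>y :: real \<times> real \<times> real. - fst (snd y)) has_derivative (\<lambda>d. - fst (snd d))) (at ?y within S)"
        by (auto intro!: derivative_eq_intros)
      from DERIV_compose_FDERIV[OF has_real_derivative_powr this, of "1 - q"]
      show ?thesis using x by (simp add: X_def)
    qed
    have "((\<lambda>y. V y * X y * profile q (Z y)) has_derivative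
        (\<lambda>(dt, dx, dv). Pt ?y * dt + Px ?y * dx + Pv ?y * dv)) (at ?y within S)"
      by (rule has_derivative_eq_rhs[OF has_derivative_mult[OF has_derivative_mult[OF Vd Xd] prof]])
        (simp add: fun_eq_iff Pt_def Px_def Pv_def V_def V'_def X_def algebra_simps)
    then show "((\<lambda>(t', x', v'). real_of_ereal (phi q T t' x' v')) has_derivative
             (\<lambda>(dt, dx, dv). Pt (t, x, v) * dt + Px (t, x, v) * dx + Pv (t, x, v) * dv))
            (at (t, x, v) within S)"
    \<comment> \<open>The self-similar formula holds at points with \<open>x < 0\<close>, which
      suffices for a derivative within \<open>S\<close>.\<close>
    proof (rule has_derivative_transform[rotated 2])
      fix y assume "y \<in> S"
      then show "(case y of (t', x', v') \<Rightarrow> real_of_ereal (phi q T t' x' v')) = V y * X y * profile q (Z y)"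
        by (cases y) (simp add: S_def phi_self_similar[OF q] V_def X_def Z_def)
    qed (rule S)
    show "- Pt ?y - v * Px ?y + (1 / p) * \<bar>Pv ?y\<bar> powr p = 0"
    \<comment> \<open>For \<open>v \<le> 0\<close> both \<open>V\<close> and \<open>V'\<close>
      vanish, hence so do all three partial derivatives.\<close>
    proof (cases "v > 0")
      case False
      then show ?thesis
        using q by (simp add: Pt_def Px_def Pv_def V_def V'_def max_absorb1)
    next
      case True
      define z where "z = Z ?y"
      define y where "y = - x"
      have y: "y > 0" using x by (simp add: y_def)
      have zT: "(T - t) / y = z / v"
        using True by (simp add: z_def Z_def y_def)
      have powers: "v powr (2 * q - 1) = v * v powr (2 * q - 2)" "v powr (2 * q) = v * v powr (2 * q - 1)"
          "y powr (1 - q) = y * y powr (- q)"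
        using True y powr_mult_base[of v "2 * q - 2"] powr_mult_base[of v "2 * q - 1"]
          powr_mult_base[of y "- q"] by simp_all
      have "Pv ?y = (2 * q - 1) * v powr (2 * q - 2) * y powr (1 - q) * profile q z
          + v powr (2 * q - 1) * y powr (1 - q) * (profile' q z * ((T - t) / y))"
        using True by (simp add: Pv_def V_def V'_def X_def y_def z_def)
      also have "\<dots> = v powr (2 * q - 2) * y powr (1 - q) * ((2 * q - 1) * profile q z + z * profile' q z)"
        unfolding powers(1) zT using True by (simp add: algebra_simps)
      \<comment> \<open>The power \<open>p\<close> turns the exponents \<open>2 * q - 2\<close> and
        \<open>1 - q\<close> into \<open>2 * q\<close> and \<open>- q\<close>, the weight of the
        other two terms.\<close>
      finally have "\<bar>Pv ?y\<bar> powr p = (v powr (2 * q - 2)) powr p * (y powr (1 - q)) powr p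
          * \<bar>(2 * q - 1) * profile q z + z * profile' q z\<bar> powr p"
        by (simp add: abs_mult powr_mult)
      also have "(v powr (2 * q - 2)) powr p = v powr (2 * q)"
      proof -
        have "(2 * q - 2) * p = 2 * q"
          using q by (simp add: p_def field_simps)
        then show ?thesis by (simp add: powr_powr)
      qed
      also have "(y powr (1 - q)) powr p = y powr (- q)"
      proof -
        have "(1 - q) * p = - q"
          using q by (simp add: p_def field_simps)
        then show ?thesis by (simp add: powr_powr)
      qed
      finally have Pv: "\<bar>Pv ?y\<bar> powr p = v powr (2 * q) * y powr (- q)
          * \<bar>(2 * q - 1) * profile q z + z * profile' q z\<bar> powr p" .
      have Pt: "- Pt ?y = v powr (2 * q) * y powr (- q) * profile' q z"
      proof -
        have "- Pt ?y = v powr (2 * q - 1) * y powr (1 - q) * (profile' q z * (v / y))"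
          using True by (simp add: Pt_def V_def X_def y_def z_def)
        then show ?thesis
          using y unfolding powers(2,3) by simp
      qed
      have Px: "v * Px ?y = v powr (2 * q) * y powr (- q) * ((q - 1) * profile q z + z * profile' q z)"
      proof -
        have "Px ?y = v powr (2 * q - 1) * ((q - 1) * y powr (- q)) * profile q z
            + v powr (2 * q - 1) * y powr (1 - q) * (profile' q z * (z / y))"
          using True by (simp add: Px_def V_def X_def y_def z_def)
        also have "v powr (2 * q - 1) * y powr (1 - q) * (profile' q z * (z / y))
            = v powr (2 * q - 1) * (y powr (- q) * (z * profile' q z))"
          using y unfolding powers(3) by simp
        finally have Px_y: "Px ?y = v powr (2 * q - 1) * ((q - 1) * y powr (- q)) * profile q z
            + v powr (2 * q - 1) * (y powr (- q) * (z * profile' q z))" .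
        show ?thesis
          unfolding powers(2) Px_y by (simp add: algebra_simps)
      qed
      have "- Pt ?y - v * Px ?y + (1 / p) * \<bar>Pv ?y\<bar> powr p
          = v powr (2 * q) * y powr (- q) * ((1 - z) * profile' q z - (q - 1) * profile q z
             + (1 / p) * \<bar>(2 * q - 1) * profile q z + z * profile' q z\<bar> powr p)"
        unfolding Pv Pt Px by (simp add: algebra_simps)
      also have "\<dots> = 0"
        using profile_ode[OF q, of z] by (simp add: p_def)
      finally show ?thesis .
    qed
  qed
  ultimately show ?thesis
    by (intro exI[of _ Pt] exI[of _ Px] exI[of _ Pv] conjI allI impI)
qed

text \<open>Minimizers are compared on \<open>{t..T}\<close>, because cost and constraint ignore
  earlier times. Nonemptiness of \<open>adm\<close> excludes exactly the data at the origin with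
  outward velocity before \<open>T\<close>.\<close>

theorem theorem2p7:
  fixes q T p :: real
  assumes hq: "q > 1" and hT: "T > 0"
  defines "p \<equiv> q / (q - 1)"
  shows
   "(\<forall>t\<in>{0..T}. \<forall>x\<le>0. \<forall>v. v * (T - t) \<le> \<bar>x\<bar> \<longrightarrow> phi q T t x v = 0)
  \<and> (\<forall>t\<in>{0..<T}. \<forall>x\<le>0. \<forall>v.
        \<bar>x\<bar> \<le> v * (T - t) \<and> v * (T - t) \<le> (2*q - 1) * \<bar>x\<bar> / (q - 1) \<longrightarrow>
        phi q T t x v = ereal ((2*q - 1) powr (q - 1) / (q * (q - 1) powr (q - 1))
                              * ((v - \<bar>x\<bar> / (T - t)) powr q / (T - t) powr (q - 1))))
  \<and> (\<forall>t\<in>{0..T}. \<forall>x\<le>0. \<forall>v.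
        v * (T - t) \<ge> (2*q - 1) * \<bar>x\<bar> / (q - 1) \<and> (2*q - 1) * \<bar>x\<bar> / (q - 1) > 0 \<longrightarrow>
        phi q T t x v = ereal (q powr (q - 1) / (2*q - 1) powr q
                              * (v powr (2*q - 1) / \<bar>x\<bar> powr (q - 1))))
  \<and> (let S = {0..T} \<times> {..<0} \<times> (UNIV :: real set) in
     \<exists>Pt Px Pv :: real \<times> real \<times> real \<Rightarrow> real.
       continuous_on S Pt \<and> continuous_on S Px \<and> continuous_on S Pv \<and>
       (\<forall>t x v. (t, x, v) \<in> S \<longrightarrow>
          \<bar>phi q T t x v\<bar> \<noteq> \<infinity> \<and>
          ((\<lambda>(t', x', v'). real_of_ereal (phi q T t' x' v')) has_derivative
             (\<lambda>(dt, dx, dv). Pt (t, x, v) * dt + Px (t, x, v) * dx + Pv (t, x, v) * dv))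
            (at (t, x, v) within S) \<and>
          - Pt (t, x, v) - v * Px (t, x, v) + (1 / p) * \<bar>Pv (t, x, v)\<bar> powr p = 0))
  \<and> (\<forall>t\<in>{0..T}. \<forall>x\<le>0. \<forall>v. adm q T t x v \<noteq> {} \<longrightarrow>
        (\<exists>m\<in>adm q T t x v. ereal (cost q T t (snd (snd m))) = phi q T t x v) \<and>
        (\<forall>m1\<in>adm q T t x v. \<forall>m2\<in>adm q T t x v.
           ereal (cost q T t (snd (snd m1))) = phi q T t x v \<longrightarrow>
           ereal (cost q T t (snd (snd m2))) = phi q T t x v \<longrightarrow>
           (\<forall>s\<in>{t..T}. fst m1 s = fst m2 s)))"
proof -
  have slow: "\<forall>t\<in>{0..T}. \<forall>x\<le>0. \<forall>v. v * (T - t) \<le> \<bar>x\<bar> \<longrightarrow> phi q T t x v = 0"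
    using phi_slow(1)[OF hq] by simp
  have middle: "phi q T t x v = ereal ((2*q - 1) powr (q - 1) / (q * (q - 1) powr (q - 1))
                              * ((v - \<bar>x\<bar> / (T - t)) powr q / (T - t) powr (q - 1)))"
    if t: "t \<in> {0..<T}" and x: "x \<le> 0"
      and v: "\<bar>x\<bar> \<le> v * (T - t) \<and> v * (T - t) \<le> (2*q - 1) * \<bar>x\<bar> / (q - 1)" for t x v
  proof -
    define L where "L = T - t"
    have L: "L > 0" using t by (simp add: L_def)
    have k: "q / (q - 1) + 1 = (2 * q - 1) / (q - 1)"
      using hq by (simp add: field_simps)
    \<comment> \<open>In this range the trajectory takes the whole horizon, so
      \<open>phi_fast\<close> is used with \<open>\<tau> = T\<close>; \<open>k\<close> rewrites
      \<open>p + 1\<close>.\<close>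
    have "phi q T t x v = ereal (((2 * q - 1) / (q - 1)) powr (q - 1) / q * (v * L + x) powr q * L powr (1 - 2 * q))"
      using phi_fast(1)[OF hq, of t T T x v] t x v by (simp add: L_def k)
    also have "v * L + x = L * (v - \<bar>x\<bar> / L)"
      using L x by (simp add: field_simps)
    also have "\<dots> powr q = L powr q * (v - \<bar>x\<bar> / L) powr q"
      by (rule powr_mult)
    also have "L powr (1 - 2 * q) = 1 / (L powr q * L powr (q - 1))"
      using powr_minus_divide[of L "2 * q - 1"] L by (simp add: powr_add[symmetric])
    also have "((2 * q - 1) / (q - 1)) powr (q - 1) = (2 * q - 1) powr (q - 1) / (q - 1) powr (q - 1)"
      by (simp add: powr_divide)
    finally show ?thesis
      using L by (simp add: L_def[symmetric] mult_ac)
  qed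
  have fast: "phi q T t x v = ereal (q powr (q - 1) / (2*q - 1) powr q
                              * (v powr (2*q - 1) / \<bar>x\<bar> powr (q - 1)))"
    if t: "t \<in> {0..T}" and x: "x \<le> 0"
      and v: "v * (T - t) \<ge> (2*q - 1) * \<bar>x\<bar> / (q - 1) \<and> (2*q - 1) * \<bar>x\<bar> / (q - 1) > 0" for t x v
  proof -
    have x': "x < 0"
      using v x by (cases "x = 0") auto
    have "0 < v * (T - t)"
      using v by linarith
    then have "v > 0"
      using t by (auto simp: zero_less_mult_iff)
    moreover have "v * (T - t) / (- x) \<ge> (2 * q - 1) / (q - 1)"
    proof -
      have "(2 * q - 1) / (q - 1) * (- x) \<le> v * (T - t)"
        using v x' by simp
      then show ?thesis
        using x' by (subst pos_le_divide_eq) auto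
    qed
    moreover have "(- x) powr (1 - q) = 1 / \<bar>x\<bar> powr (q - 1)"
      using powr_minus_divide[of "- x" "q - 1"] x' by simp
    ultimately show ?thesis
      unfolding phi_self_similar[OF hq t x'] by (simp only: profile_saturated[OF hq]) (simp add: mult.commute)
  qed
  have minimizer: "(\<exists>m\<in>adm q T t x v. ereal (cost q T t (snd (snd m))) = phi q T t x v) \<and>
        (\<forall>m1\<in>adm q T t x v. \<forall>m2\<in>adm q T t x v.
           ereal (cost q T t (snd (snd m1))) = phi q T t x v \<longrightarrow>
           ereal (cost q T t (snd (snd m2))) = phi q T t x v \<longrightarrow>
           (\<forall>s\<in>{t..T}. fst m1 s = fst m2 s))"
    if t: "t \<in> {0..T}" and x: "x \<le> 0" and ne: "adm q T t x v \<noteq> {}" for t x v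
  proof (cases "v * (T - t) \<le> - x")
    case True
    show ?thesis
      using phi_slow(2,3)[OF hq t x True] by blast
  next
    case False
    then have "v * (T - t) > 0"
      using x by linarith
    then have v: "v > 0" and tT: "t < T"
      using t by (auto simp: zero_less_mult_iff)
    \<comment> \<open>At the origin an outward velocity leaves no admissible trajectory, so
      nonemptiness forces \<open>x < 0\<close>.\<close>
    have x': "x < 0"
      using adm_boundary_outward_empty[of t T v q] ne x v tT t by (cases "x = 0") auto
    have "- x < v * (T - t)"
      using False by simp
    note hor = optimal_horizon[OF hq t x' this]
    have "0 \<le> t"
      using t by simp
    from phi_fast(2,3)[OF hq this hor(2-6)] show ?thesis
      by blast
  qed
  have "\<forall>t\<in>{0..<T}. \<forall>x\<le>0. \<forall>v.
        \<bar>x\<bar> \<le> v * (T - t) \<and> v * (T - t) \<le> (2*q - 1) * \<bar>x\<bar> / (q - 1) \<longrightarrow>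
        phi q T t x v = ereal ((2*q - 1) powr (q - 1) / (q * (q - 1) powr (q - 1))
                              * ((v - \<bar>x\<bar> / (T - t)) powr q / (T - t) powr (q - 1)))"
    using middle by blast
  moreover have "\<forall>t\<in>{0..T}. \<forall>x\<le>0. \<forall>v.
        v * (T - t) \<ge> (2*q - 1) * \<bar>x\<bar> / (q - 1) \<and> (2*q - 1) * \<bar>x\<bar> / (q - 1) > 0 \<longrightarrow>
        phi q T t x v = ereal (q powr (q - 1) / (2*q - 1) powr q
                              * (v powr (2*q - 1) / \<bar>x\<bar> powr (q - 1)))"
    using fast by blast
  moreover have "\<forall>t\<in>{0..T}. \<forall>x\<le>0. \<forall>v. adm q T t x v \<noteq> {} \<longrightarrow>
        (\<exists>m\<in>adm q T t x v. ereal (cost q T t (snd (snd m))) = phi q T t x v) \<and>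
        (\<forall>m1\<in>adm q T t x v. \<forall>m2\<in>adm q T t x v.
           ereal (cost q T t (snd (snd m1))) = phi q T t x v \<longrightarrow>
           ereal (cost q T t (snd (snd m2))) = phi q T t x v \<longrightarrow>
           (\<forall>s\<in>{t..T}. fst m1 s = fst m2 s))"
    by (intro ballI allI impI minimizer)
  ultimately show ?thesis
    unfolding Let_def p_def using phi_C1_solution[OF hq, of T]
    by (intro conjI slow)
qed

end
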